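(* Let $d\ge 1$, $\Omega=(-\pi,\pi)^d$ with periodic boundary conditions, let $\lambda\in[0,1]$ and $0<c_2\le 1$. Consider the exponential Runge--Kutta scheme with time step size $\tau>0$ $$\begin{aligned} U &= u^n + c_2\tau\varphi_1(c_2\tau\lambda\Delta)\Delta u^n,\\ u^{n+1} &= u^n + \tau\varphi_1(\tau\lambda\Delta)\Delta u^n+\frac{\tau}{2c_2}\varphi_1(\tau\lambda\Delta)(1-\lambda)\Delta(U-u^n) \end{aligned}$$ for the heat equation $\partial_t u=\lambda\Delta u+(1-\lambda)\Delta u$ on $\Omega$. If $\lambda\ge \frac{1}{1+2c_2}$, then this scheme is unconditionally stable.
   Context: The function $\varphi_1(z)=(\mathrm{e}^z-1)/z$, with $\varphi_1(0)=1$, is entire; functions of $\Delta$ act on periodic functions as Fourier multipliers, $\Delta$ acting on the $\boldsymbol k$-th Fourier mode ($\boldsymbol k\in\mathbb{Z}^d$) as multiplication by $-k^2$, where $k^2=\sum_{\mu=1}^d k_\mu^2$. The scheme therefore acts on each Fourier coefficient $\hat u^n_{\boldsymbol k}$ of $u^n$ by $\hat u^{n+1}_{\boldsymbol k}=\Phi(z,\lambda)\,\hat u^n_{\boldsymbol k}$ with $z=-\tau k^2$, where the stability function $\Phi(z,\lambda)$ is the scalar amplification factor obtained by formally replacing every occurrence of $\tau\Delta$ in the scheme by the real number $z$ and eliminating $U$. The scheme (with parameters $\lambda$, $c_2$) is called unconditionally stable if $|\Phi(z,\lambda)|\le 1$ for all $z\in(-\infty,0]$. *)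

theory Defs
  imports "HOL-Analysis.Analysis"
begin

definition phi1 :: "'a::{real_normed_field,banach} \<Rightarrow> 'a" where
  "phi1 z = (if z = 0 then 1 else (exp z - 1) / z)"

text \<open>
  The dimension \<open>d\<close> is the cardinality of the index type \<^typ>\<open>'d\<close>, so that \<open>d \<ge> 1\<close>.
\<close>

definition Omega :: "(real ^ 'd) set" where
  "Omega = box (\<chi> i. - pi) (\<chi> i. pi)"

definition periodic_integrable :: "(real ^ 'd \<Rightarrow> complex) \<Rightarrow> bool" where
  "periodic_integrable u \<longleftrightarrow>
     (\<forall>x i. u (x + axis i (2 * pi)) = u x) \<and> set_integrable lborel Omega u"

definition fourier_coeff :: "(real ^ 'd \<Rightarrow> complex) \<Rightarrow> int ^ 'd \<Rightarrow> complex" where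
  "fourier_coeff u k =
     (LINT x:Omega|lborel. u x * cis (- (\<Sum>i\<in>UNIV. of_int (k $ i) * x $ i)))
       / of_real ((2 * pi) ^ CARD('d))"

definition freq_sq :: "int ^ 'd \<Rightarrow> real" where
  "freq_sq k = (\<Sum>i\<in>UNIV. (of_int (k $ i))\<^sup>2)"

text \<open>
  \<open>laplacian_fun g u v\<close> says that \<open>v = g(\<Delta>) u\<close>, with \<open>g(\<Delta>)\<close> acting as a Fourier multiplier.
  It is a relation because \<open>g(\<Delta>)\<close> may be unbounded; \<open>v\<close> is determined by \<open>u\<close> up to null sets.
\<close>

definition laplacian_fun ::
  "(real \<Rightarrow> real) \<Rightarrow> (real ^ 'd \<Rightarrow> complex) \<Rightarrow> (real ^ 'd \<Rightarrow> complex) \<Rightarrow> bool" where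
  "laplacian_fun g u v \<longleftrightarrow> periodic_integrable u \<and> periodic_integrable v \<and>
     (\<forall>k. fourier_coeff v k = of_real (g (- freq_sq k)) * fourier_coeff u k)"

text \<open>
  One step of the exponential Runge--Kutta scheme, from \<open>u\<close> (playing the role of \<open>u\<^sup>n\<close>) through
  the internal stage \<open>U\<close> to \<open>u'\<close> (playing the role of \<open>u\<^bsup>n+1\<^esup>\<close>).
\<close>

definition erk_step ::
  "real \<Rightarrow> real \<Rightarrow> real \<Rightarrow> (real ^ 'd \<Rightarrow> complex) \<Rightarrow> (real ^ 'd \<Rightarrow> complex)
     \<Rightarrow> (real ^ 'd \<Rightarrow> complex) \<Rightarrow> bool" where
  "erk_step \<tau> c2 lam u U u' \<longleftrightarrow>
     (\<exists>v1 v2 v3.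
        laplacian_fun (\<lambda>D. phi1 (c2 * \<tau> * lam * D) * D) u v1 \<and>
        laplacian_fun (\<lambda>D. phi1 (\<tau> * lam * D) * D) u v2 \<and>
        laplacian_fun (\<lambda>D. phi1 (\<tau> * lam * D) * (1 - lam) * D) (\<lambda>x. U x - u x) v3 \<and>
        (\<forall>x. U x = u x + of_real (c2 * \<tau>) * v1 x) \<and>
        (\<forall>x. u' x = u x + of_real \<tau> * v2 x + of_real (\<tau> / (2 * c2)) * v3 x))"

text \<open>
  The scheme with \<open>\<tau> \<Delta>\<close> replaced by the number \<open>z\<close> and \<open>u\<^sup>n\<close> by \<open>1\<close>; see
  \<open>fourier_coeff_erk_step\<close> below for the relation to \<^const>\<open>erk_step\<close>.
\<close>

definition stability_function :: "real \<Rightarrow> real \<Rightarrow> real \<Rightarrow> real" where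
  "stability_function c2 z lam =
     (let U = 1 + c2 * phi1 (c2 * lam * z) * z
      in 1 + phi1 (lam * z) * z + 1 / (2 * c2) * phi1 (lam * z) * (1 - lam) * z * (U - 1))"

definition unconditionally_stable :: "real \<Rightarrow> real \<Rightarrow> bool" where
  "unconditionally_stable c2 lam \<longleftrightarrow> (\<forall>z\<le>0. \<bar>stability_function c2 z lam\<bar> \<le> 1)"

lemma set_integrable_mult_cis:
  fixes u :: "real ^ 'd \<Rightarrow> complex"
  assumes "set_integrable lborel Omega u"
  shows "set_integrable lborel Omega
           (\<lambda>x. u x * cis (- (\<Sum>i\<in>UNIV. of_int (k $ i) * x $ i)))"
proof -
  have m: "(\<lambda>x::real^'d. cis (- (\<Sum>i\<in>UNIV. of_int (k $ i) * x $ i))) \<in> borel_measurable lborel"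
  proof -
    have "continuous_on UNIV (\<lambda>x::real^'d. cis (- (\<Sum>i\<in>UNIV. of_int (k $ i) * x $ i)))"
      unfolding cis_conv_exp by (intro continuous_intros)
    then show ?thesis
      by (simp add: borel_measurable_continuous_onI)
  qed
  show ?thesis
    unfolding set_integrable_def
  proof (rule Bochner_Integration.integrable_bound)
    show "integrable lborel (\<lambda>x. indicator Omega x *\<^sub>R u x)"
      using assms by (simp add: set_integrable_def)
    then have "(\<lambda>x. indicator Omega x *\<^sub>R u x) \<in> borel_measurable lborel"
      by (rule borel_measurable_integrable)
    from borel_measurable_times[OF this m]
    show "(\<lambda>x. indicator Omega x *\<^sub>R
            (u x * cis (- (\<Sum>i\<in>UNIV. of_int (k $ i) * x $ i)))) \<in> borel_measurable lborel"
      by simp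
  qed (simp add: norm_mult)
qed

lemma fourier_coeff_add:
  assumes "periodic_integrable u" "periodic_integrable v"
  shows "fourier_coeff (\<lambda>x. u x + v x) k = fourier_coeff u k + fourier_coeff v k"
  using set_integral_add(2)[OF set_integrable_mult_cis set_integrable_mult_cis, of u v k k] assms
  by (simp add: fourier_coeff_def periodic_integrable_def distrib_right add_divide_distrib)

lemma fourier_coeff_cmult: "fourier_coeff (\<lambda>x. c * u x) k = c * fourier_coeff u k"
  by (simp add: fourier_coeff_def mult.assoc)

lemma periodic_integrable_add:
  "periodic_integrable u \<Longrightarrow> periodic_integrable v \<Longrightarrow> periodic_integrable (\<lambda>x. u x + v x)"
  by (simp add: periodic_integrable_def set_integral_add)

lemma periodic_integrable_cmult:
  "periodic_integrable u \<Longrightarrow> periodic_integrable (\<lambda>x. c * u x)"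
  by (simp add: periodic_integrable_def)

lemma fourier_coeff_erk_step:
  assumes "erk_step \<tau> c2 lam u U u'"
  shows "fourier_coeff u' k =
           of_real (stability_function c2 (- \<tau> * freq_sq k) lam) * fourier_coeff u k"
proof -
  from assms obtain v1 v2 v3 where
      v1: "laplacian_fun (\<lambda>D. phi1 (c2 * \<tau> * lam * D) * D) u v1" and
      v2: "laplacian_fun (\<lambda>D. phi1 (\<tau> * lam * D) * D) u v2" and
      v3: "laplacian_fun (\<lambda>D. phi1 (\<tau> * lam * D) * (1 - lam) * D) (\<lambda>x. U x - u x) v3" and
      U: "\<forall>x. U x = u x + of_real (c2 * \<tau>) * v1 x" and
      u': "\<forall>x. u' x = u x + of_real \<tau> * v2 x + of_real (\<tau> / (2 * c2)) * v3 x"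
    unfolding erk_step_def by blast
  have p: "periodic_integrable u" "periodic_integrable v2" "periodic_integrable v3"
    using v1 v2 v3 by (auto simp: laplacian_fun_def)
  have d: "(\<lambda>x. U x - u x) = (\<lambda>x. of_real (c2 * \<tau>) * v1 x)"
    using U by auto
  have e: "u' = (\<lambda>x. (u x + of_real \<tau> * v2 x) + of_real (\<tau> / (2 * c2)) * v3 x)"
    using u' by auto
  have "fourier_coeff u' k = fourier_coeff u k + of_real \<tau> * fourier_coeff v2 k
          + of_real (\<tau> / (2 * c2)) * fourier_coeff v3 k"
    unfolding e
    by (simp only: fourier_coeff_add fourier_coeff_cmult periodic_integrable_add
        periodic_integrable_cmult p)
  moreover have "fourier_coeff v1 k =
      of_real (phi1 (c2 * \<tau> * lam * (- freq_sq k)) * (- freq_sq k)) * fourier_coeff u k"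
    using v1 by (simp add: laplacian_fun_def)
  moreover have "fourier_coeff v2 k =
      of_real (phi1 (\<tau> * lam * (- freq_sq k)) * (- freq_sq k)) * fourier_coeff u k"
    using v2 by (simp add: laplacian_fun_def)
  moreover have "fourier_coeff v3 k =
      of_real (phi1 (\<tau> * lam * (- freq_sq k)) * (1 - lam) * (- freq_sq k))
        * (of_real (c2 * \<tau>) * fourier_coeff v1 k)"
    using v3 unfolding d laplacian_fun_def fourier_coeff_cmult by blast
  ultimately show ?thesis
    unfolding stability_function_def Let_def
    by (cases "c2 = 0") (simp_all add: field_simps)
qed

end

theory Submission imports Defs begin

text \<open>
  With \<open>A = 1 - exp (lam z)\<close> and \<open>B = 1 - exp (c2 lam z)\<close>, both in \<open>[0, 1]\<close>, the stability function
  is \<open>1 - A / lam + (1 - lam) A B / (2 c2 lam\<^sup>2)\<close>. The bound \<open>1\<close> from above is the hypothesis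
  \<open>1 - lam \<le> 2 c2 lam\<close> together with \<open>B \<le> 1\<close>. The bound \<open>-1\<close> from below is immediate for
  \<open>lam \<ge> 1 / 2\<close>; otherwise convexity of \<open>exp\<close> gives \<open>B \<ge> c2 A\<close>, which leaves a positive
  quadratic polynomial in \<open>A / lam\<close>.
\<close>

text \<open>The factor \<open>a\<close> replaces a division, so the identity also covers
  \<open>a = 0\<close> and \<open>z = 0\<close>.\<close>

lemma phi1_mult: "a * (phi1 (a * z) * z) = exp (a * z) - 1"
  by (auto simp: phi1_def)

lemma exp_mult_le_convex_combination:
  fixes c y :: real
  assumes "0 \<le> c" "c \<le> 1"
  shows "exp (c * y) \<le> 1 - c + c * exp y"
  using convex_onD[OF exp_convex, of c 0 y] assms by simp

lemma stability_function_eq: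
  assumes "lam \<noteq> 0" "c2 \<noteq> 0"
  shows "stability_function c2 z lam =
    1 - (1 - exp (lam * z)) / lam
      + (1 - lam) / (2 * c2 * lam\<^sup>2) * ((1 - exp (lam * z)) * (1 - exp (c2 * lam * z)))"
proof -
  have 1: "phi1 (lam * z) * z = (exp (lam * z) - 1) / lam"
    using phi1_mult[of lam z] assms by (simp add: field_simps)
  have 2: "c2 * phi1 (c2 * lam * z) * z = (exp (c2 * lam * z) - 1) / lam"
    using phi1_mult[of "c2 * lam" z] assms by (simp add: field_simps)
  have "stability_function c2 z lam = 1 + phi1 (lam * z) * z
      + 1 / (2 * c2) * (1 - lam) * (phi1 (lam * z) * z) * (c2 * phi1 (c2 * lam * z) * z)"
    by (simp add: stability_function_def)
  also have "\<dots> = 1 - (1 - exp (lam * z)) / lam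
      + (1 - lam) / (2 * c2 * lam\<^sup>2) * ((1 - exp (lam * z)) * (1 - exp (c2 * lam * z)))"
    unfolding 1 2 using assms by (simp add: divide_simps) (simp add: algebra_simps power2_eq_square)
  finally show ?thesis .
qed

theorem theorem2p5:
  fixes c2 lam :: real
  assumes "0 \<le> lam" and "lam \<le> 1"
    and "0 < c2" and "c2 \<le> 1"
    and "lam \<ge> 1 / (1 + 2 * c2)"
  shows "unconditionally_stable c2 lam"
  unfolding unconditionally_stable_def
proof (intro allI impI)
  fix z :: real
  assume "z \<le> 0"
  have "0 < 1 / (1 + 2 * c2)" using assms by simp
  then have lam: "0 < lam" using assms by linarith
  have h: "1 - lam \<le> 2 * c2 * lam"
    using assms by (simp add: field_simps)
  define A where "A = 1 - exp (lam * z)"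
  define B where "B = 1 - exp (c2 * lam * z)"
  define K where "K = (1 - lam) / (2 * c2 * lam\<^sup>2)"
  have A: "0 \<le> A" "A \<le> 1"
    using lam \<open>z \<le> 0\<close> by (auto simp: A_def mult_nonneg_nonpos)
  have B: "0 \<le> B" "B \<le> 1"
    using lam assms \<open>z \<le> 0\<close> by (auto simp: B_def mult_nonneg_nonpos)
  have "c2 * A \<le> B"
    using exp_mult_le_convex_combination[of c2 "lam * z"] assms
    by (simp add: A_def B_def algebra_simps)
  \<comment> \<open>Clearing denominators turns the second bound into \<open>h\<close> multiplied by
    \<open>lam\<close>.\<close>
  have K: "0 \<le> K" "K \<le> 1 / lam"
    using assms lam mult_left_mono[OF h, of lam]
    by (simp_all add: K_def field_simps power2_eq_square)
  have \<Phi>: "stability_function c2 z lam = 1 - A / lam + K * (A * B)"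
    using stability_function_eq[of lam c2 z] lam assms by (simp add: A_def B_def K_def)
  have "K * (A * B) \<le> 1 / lam * (A * 1)"
    using A B K lam by (intro mult_mono) auto
  then have upper: "stability_function c2 z lam \<le> 1"
    by (simp add: \<Phi>)
  have lower: "- 1 \<le> stability_function c2 z lam"
  proof (cases "1 / 2 \<le> lam")
    case True
    \<comment> \<open>Here \<open>A \<le> 1 \<le> 2 * lam\<close>.\<close>
    then have "A / lam \<le> 2"
      using A lam by (simp add: field_simps)
    moreover have "0 \<le> K * (A * B)"
      using A B K by simp
    ultimately show ?thesis by (simp add: \<Phi>)
  next
    case False
    define a where "a = A / lam"
    have "(1 - lam) / 2 * a\<^sup>2 = K * (A * (c2 * A))"
      using lam assms by (simp add: a_def K_def field_simps power2_eq_square)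
    also have "\<dots> \<le> K * (A * B)"
      using A K \<open>c2 * A \<le> B\<close> by (intro mult_left_mono) auto
    finally have "(1 - lam) / 2 * a\<^sup>2 \<le> K * (A * B)" .
    \<comment> \<open>\<open>lam < 1 / 2\<close> makes the coefficient at least 1/4, exactly what
      completes the square: the stability function is then at least
      \<open>(1 - a / 2)\<^sup>2\<close>, hence even nonnegative.\<close>
    moreover have "1 / 4 * a\<^sup>2 \<le> (1 - lam) / 2 * a\<^sup>2"
      using False by (intro mult_right_mono) auto
    moreover have "0 \<le> (1 - a / 2)\<^sup>2" by simp
    then have "0 \<le> 1 - a + 1 / 4 * a\<^sup>2"
      by (simp add: power2_eq_square algebra_simps)
    ultimately show ?thesis by (simp add: \<Phi> flip: a_def)
  qed
  show "\<bar>stability_function c2 z lam\<bar> \<le> 1"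
    using upper lower by (simp add: abs_le_iff)
qed

end
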